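(* Let $1<p<\infty$, let $U\subset\mathbb R^N$ be open and $w\in C^2(U)$. With the notation of the context, for every $x\in U$ with $\nabla w(x)\neq0$ the following statements hold (all quantities evaluated at $x$). (i) If $p=2$, then $M_2[w]=D^2w$. (ii) If $N=1$, then $M_p[w]=(p-1)|w'|^{p-2}w''$, and hence $M_p[w]\geq0\Longleftrightarrow w''\geq0$. (iii) If $\nabla_\Sigma s=0$, then, with respect to $\mathbb R^N=T_x\Sigma_x\oplus\operatorname{span}\{\nu\}$, \[ D^2w=\begin{pmatrix}s\,\mathrm{II}&0\\0&\partial_\nu s\end{pmatrix},\qquad M_p[w]=s^{p-2}\begin{pmatrix}s\,\mathrm{II}&0\\0&(p-1)\partial_\nu s\end{pmatrix}, \] and consequently $D^2w\geq0\Longleftrightarrow M_p[w]\geq0$.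
   Context: For $w\in C^2(U)$ set $s:=|\nabla w|$ and $A:=|\nabla w|^{p-2}\nabla w$. At points where $\nabla w\neq0$ let \[ M_p[w]:=\frac12\bigl(DA+(DA)^T\bigr), \] where $DA$ is the Jacobian matrix of $A$. For $x\in U$ with $\nabla w(x)\neq0$ let $\nu:=\nabla w/s$ and $\Sigma_x:=\{y\in U:w(y)=w(x)\}$, a $C^2$ hypersurface near $x$ with tangent space $T_x\Sigma_x$ and second fundamental form $\mathrm{II}(\tau,\eta):=\langle D_\tau\nu,\eta\rangle$ for $\tau,\eta\in T_x\Sigma_x$, viewed as a symmetric bilinear form on $T_x\Sigma_x$. The vector $\nabla_\Sigma s\in T_x\Sigma_x$ is the tangential gradient of $s$ and $\partial_\nu s:=\langle\nabla s,\nu\rangle$, so $\nabla s=\nabla_\Sigma s+(\partial_\nu s)\nu$. For symmetric matrices, $\geq0$ means positive semidefinite. *)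

theory Defs
  imports "HOL-Analysis.Analysis"
begin

definition grad :: "(real^'n \<Rightarrow> real) \<Rightarrow> real^'n \<Rightarrow> real^'n" where
  "grad f x = (\<chi> i. frechet_derivative f (at x) (axis i 1))"

definition hessian :: "(real^'n \<Rightarrow> real) \<Rightarrow> real^'n \<Rightarrow> real^'n^'n" where
  "hessian f x = jacobian (grad f) (at x)"

text \<open>Derivatives are taken at \<open>x\<close> in the whole space, so this is meant for open \<open>U\<close>.\<close>

definition C2_on :: "(real^'n) set \<Rightarrow> (real^'n \<Rightarrow> real) \<Rightarrow> bool" where
  "C2_on U w \<longleftrightarrow>
     (\<forall>x\<in>U. w differentiable (at x)) \<and>
     (\<forall>x\<in>U. grad w differentiable (at x)) \<and>
     continuous_on U (hessian w)"

definition slope :: "(real^'n \<Rightarrow> real) \<Rightarrow> real^'n \<Rightarrow> real" where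
  "slope w x = norm (grad w x)"

definition flux :: "real \<Rightarrow> (real^'n \<Rightarrow> real) \<Rightarrow> real^'n \<Rightarrow> real^'n" where
  "flux p w x = norm (grad w x) powr (p - 2) *\<^sub>R grad w x"

definition Mp :: "real \<Rightarrow> (real^'n \<Rightarrow> real) \<Rightarrow> real^'n \<Rightarrow> real^'n^'n" where
  "Mp p w x = (1/2) *\<^sub>R (jacobian (flux p w) (at x) + transpose (jacobian (flux p w) (at x)))"

definition psd :: "real^'n^'n \<Rightarrow> bool" where
  "psd B \<longleftrightarrow> transpose B = B \<and> (\<forall>v. 0 \<le> v \<bullet> (B *v v))"

definition unit_normal :: "(real^'n \<Rightarrow> real) \<Rightarrow> real^'n \<Rightarrow> real^'n" where
  "unit_normal w x = grad w x /\<^sub>R slope w x"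

definition level_set :: "(real^'n) set \<Rightarrow> (real^'n \<Rightarrow> real) \<Rightarrow> real^'n \<Rightarrow> (real^'n) set" where
  "level_set U w x = {y \<in> U. w y = w x}"

text \<open>Velocities at \<open>x\<close> of \<open>C\<^sup>1\<close> curves lying in \<open>S\<close>; this is the usual tangent space when
  \<open>S\<close> is a hypersurface near \<open>x\<close>.\<close>

definition tangent_space :: "(real^'n) set \<Rightarrow> real^'n \<Rightarrow> (real^'n) set" where
  "tangent_space S x =
     {v. \<exists>\<gamma> \<epsilon>. 0 < \<epsilon> \<and> \<gamma> C1_differentiable_on {-\<epsilon><..<\<epsilon>} \<and> \<gamma> ` {-\<epsilon><..<\<epsilon>} \<subseteq> S \<and>
             \<gamma> 0 = x \<and> (\<gamma> has_vector_derivative v) (at 0)}"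

text \<open>Only meaningful for \<open>\<tau>\<close> and \<open>\<eta>\<close> in the tangent space of the level set.\<close>

definition second_fundamental_form ::
    "(real^'n \<Rightarrow> real) \<Rightarrow> real^'n \<Rightarrow> real^'n \<Rightarrow> real^'n \<Rightarrow> real" where
  "second_fundamental_form w x \<tau> \<eta> = frechet_derivative (unit_normal w) (at x) \<tau> \<bullet> \<eta>"

text \<open>The vector of the subspace \<open>T\<close> representing the derivative of \<open>f\<close> at \<open>x\<close> restricted to
  \<open>T\<close>, i.e. the orthogonal projection of the gradient onto \<open>T\<close>.\<close>

definition tangential_grad :: "(real^'n) set \<Rightarrow> (real^'n \<Rightarrow> real) \<Rightarrow> real^'n \<Rightarrow> real^'n" where
  "tangential_grad T f x =
     (THE g. g \<in> T \<and> (\<forall>\<tau>\<in>T. g \<bullet> \<tau> = frechet_derivative f (at x) \<tau>))"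

definition normal_derivative :: "(real^'n \<Rightarrow> real) \<Rightarrow> (real^'n \<Rightarrow> real) \<Rightarrow> real^'n \<Rightarrow> real" where
  "normal_derivative w f x = grad f x \<bullet> unit_normal w x"

text \<open>The whole space is the orthogonal sum of \<open>T\<close> and the line spanned by the unit vector \<open>\<nu>\<close>,
  and the bilinear form of \<open>B\<close> has, with respect to it, the diagonal blocks \<open>\<beta>\<close> (a bilinear form
  on \<open>T\<close>) and \<open>c\<close>, and vanishing off-diagonal blocks.\<close>

definition block_diagonal ::
    "(real^'n) set \<Rightarrow> real^'n \<Rightarrow> real^'n^'n \<Rightarrow> (real^'n \<Rightarrow> real^'n \<Rightarrow> real) \<Rightarrow> real \<Rightarrow> bool" where
  "block_diagonal T \<nu> B \<beta> c \<longleftrightarrow>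
     subspace T \<and> norm \<nu> = 1 \<and> (\<forall>\<tau>\<in>T. orthogonal \<tau> \<nu>) \<and>
     (\<forall>z. \<exists>\<tau>\<in>T. \<exists>a. z = \<tau> + a *\<^sub>R \<nu>) \<and>
     (\<forall>\<tau>\<in>T. \<forall>\<eta>\<in>T. \<tau> \<bullet> (B *v \<eta>) = \<beta> \<tau> \<eta>) \<and>
     (\<forall>\<tau>\<in>T. \<tau> \<bullet> (B *v \<nu>) = 0) \<and>
     (\<forall>\<eta>\<in>T. \<nu> \<bullet> (B *v \<eta>) = 0) \<and>
     \<nu> \<bullet> (B *v \<nu>) = c"

end

theory Submission imports Defs begin

text \<open>Write \<open>H\<close> for the Hessian, symmetric because both \<open>H v \<bullet> u\<close> and \<open>H u \<bullet> v\<close> are limits of the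
  same second difference quotient. Then \<open>\<nabla>s = H \<nu>\<close> and \<open>s II\<close> is \<open>H\<close> restricted to the tangent space
  \<open>\<nu>\<^sup>\<bottom>\<close>, while \<open>DA\<close> is \<open>s\<^sup>p\<^sup>-\<^sup>2 (H + (p - 2) \<nu> (H \<nu>)\<^sup>T)\<close>. When the tangential gradient of \<open>s\<close> vanishes,
  \<open>H \<nu>\<close> is a multiple of \<open>\<nu>\<close>, so both matrices are block diagonal, with blocks differing by the
  positive factors \<open>s\<^sup>p\<^sup>-\<^sup>2\<close> and \<open>(p - 1) s\<^sup>p\<^sup>-\<^sup>2\<close>.\<close>

section \<open>Symmetry of the second derivative\<close>

text \<open>The mean value theorem in direction \<open>u\<close> turns the second difference into
  \<open>t\<close> times an increment of \<open>g\<close> over \<open>t *\<^sub>R v\<close>, paired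
  with \<open>u\<close>. Differentiability of \<open>g\<close> at the single point \<open>x\<close>
  evaluates that increment as \<open>t *\<^sub>R H v\<close> up to an error small compared with
  \<open>t\<close>.\<close>

lemma second_difference_quotient_tendsto:
  fixes f :: "'a::real_inner \<Rightarrow> real" and g :: "'a \<Rightarrow> 'a"
  assumes U: "open U" "x \<in> U"
    and f: "\<And>y. y \<in> U \<Longrightarrow> (f has_derivative (\<lambda>h. g y \<bullet> h)) (at y)"
    and g: "(g has_derivative H) (at x)"
  shows "((\<lambda>t. (f (x + t *\<^sub>R u + t *\<^sub>R v) - f (x + t *\<^sub>R u) - f (x + t *\<^sub>R v) + f x) / t\<^sup>2)
           \<longlongrightarrow> H v \<bullet> u) (at_right 0)"
proof (rule tendstoI)
  fix e :: real assume "e > 0"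
  interpret H: bounded_linear H using g by (rule has_derivative_bounded_linear)
  define N where "N = norm u + norm v + 1"
  have N: "N > 0" by (simp add: N_def add_nonneg_pos)
  \<comment> \<open>Chosen so that the two linearisation errors below, each at most
    \<open>k * (t * N)\<close>, contribute at most \<open>t * (e / 2)\<close> once paired with
    \<open>u\<close>.\<close>
  define k where "k = e / (4 * N\<^sup>2)"
  have k: "k > 0" using \<open>e > 0\<close> N by (simp add: k_def)
  obtain d where d: "d > 0" and gd: "\<And>y. norm (y - x) < d \<Longrightarrow>
      norm (g y - g x - H (y - x)) \<le> k * norm (y - x)"
    using g k unfolding has_derivative_at_alt by blast
  obtain r where r: "r > 0" "ball x r \<subseteq> U"
    using U open_contains_ball by blast
  \<comment> \<open>For \<open>t < m\<close> the whole parallelogram of points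
    \<open>x + a *\<^sub>R u + b *\<^sub>R v\<close> with \<open>a\<close> and \<open>b\<close>
    between 0 and \<open>t\<close> lies in \<open>U\<close> and in the ball where \<open>gd\<close>
    applies.\<close>
  define m where "m = min d r / N"
  have m: "m > 0" using d r N by (simp add: m_def)
  show "\<forall>\<^sub>F t in at_right 0. dist
     ((f (x + t *\<^sub>R u + t *\<^sub>R v) - f (x + t *\<^sub>R u) - f (x + t *\<^sub>R v) + f x) / t\<^sup>2) (H v \<bullet> u) < e"
    unfolding eventually_at_right_field
  proof (intro exI[of _ m] conjI allI impI m)
    fix t assume t: "0 < t" "t < m"
    have small: "norm (a *\<^sub>R u + b *\<^sub>R v) \<le> t * N \<and> norm (a *\<^sub>R u + b *\<^sub>R v) < min d r"
      if "0 \<le> a" "a \<le> t" "0 \<le> b" "b \<le> t" for a b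
    proof -
      have "norm (a *\<^sub>R u + b *\<^sub>R v) \<le> norm (a *\<^sub>R u) + norm (b *\<^sub>R v)"
        by (rule norm_triangle_ineq)
      also have "\<dots> = a * norm u + b * norm v" using that by simp
      also have "\<dots> \<le> t * norm u + t * norm v"
        using that by (intro add_mono mult_right_mono) auto
      also have "\<dots> \<le> t * N" using t by (simp add: N_def algebra_simps)
      finally have *: "norm (a *\<^sub>R u + b *\<^sub>R v) \<le> t * N" .
      have "t * N < min d r" using t N by (simp add: m_def pos_less_divide_eq)
      then show ?thesis using * by linarith
    qed
    have inU: "x + a *\<^sub>R u + b *\<^sub>R v \<in> U" if "0 \<le> a" "a \<le> t" "0 \<le> b" "b \<le> t" for a b
    proof -
      have "dist x (x + a *\<^sub>R u + b *\<^sub>R v) = norm (a *\<^sub>R u + b *\<^sub>R v)"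
        by (metis add.assoc add_diff_cancel_left' dist_commute dist_norm)
      also have "\<dots> < r" using small[OF that] by simp
      finally have "dist x (x + a *\<^sub>R u + b *\<^sub>R v) < r" .
      then show ?thesis using r by auto
    qed
    have gest: "norm (g (x + a *\<^sub>R u + b *\<^sub>R v) - g x - H (a *\<^sub>R u + b *\<^sub>R v)) \<le> k * (t * N)"
      if "0 \<le> a" "a \<le> t" "0 \<le> b" "b \<le> t" for a b
    proof -
      have "norm (g (x + a *\<^sub>R u + b *\<^sub>R v) - g x - H (a *\<^sub>R u + b *\<^sub>R v))
          \<le> k * norm (a *\<^sub>R u + b *\<^sub>R v)"
        using gd[of "x + a *\<^sub>R u + b *\<^sub>R v"] small[OF that] by (simp add: add.assoc)
      also have "\<dots> \<le> k * (t * N)" using small[OF that] k by (intro mult_left_mono) auto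
      finally show ?thesis .
    qed
    define \<phi> where "\<phi> = (\<lambda>a. f (x + a *\<^sub>R u + t *\<^sub>R v) - f (x + a *\<^sub>R u))"
    have der: "(\<phi> has_derivative
        (\<lambda>h. (g (x + a *\<^sub>R u + t *\<^sub>R v) - g (x + a *\<^sub>R u)) \<bullet> (h *\<^sub>R u))) (at a)"
      if "0 \<le> a" "a \<le> t" for a
    proof -
      have 1: "((\<lambda>a. f (x + a *\<^sub>R u + t *\<^sub>R v)) has_derivative
          (\<lambda>h. g (x + a *\<^sub>R u + t *\<^sub>R v) \<bullet> (h *\<^sub>R u))) (at a)"
        by (rule has_derivative_compose[where g = f])
          (use that t f[OF inU[of a t]] in \<open>auto intro!: derivative_eq_intros\<close>)
      have 2: "((\<lambda>a. f (x + a *\<^sub>R u)) has_derivative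
          (\<lambda>h. g (x + a *\<^sub>R u) \<bullet> (h *\<^sub>R u))) (at a)"
        by (rule has_derivative_compose[where g = f])
          (use that t f[OF inU[of a 0]] in \<open>auto intro!: derivative_eq_intros\<close>)
      show ?thesis unfolding \<phi>_def
        by (rule has_derivative_eq_rhs[OF has_derivative_diff[OF 1 2]])
          (simp add: inner_diff_left right_diff_distrib)
    qed
    obtain a where a: "0 < a" "a < t" and
      mv: "\<phi> t - \<phi> 0 = (g (x + a *\<^sub>R u + t *\<^sub>R v) - g (x + a *\<^sub>R u)) \<bullet> (t *\<^sub>R u)"
    proof -
      have "\<exists>a\<in>{0<..<t}. \<phi> t - \<phi> 0 =
          (\<lambda>h. (g (x + a *\<^sub>R u + t *\<^sub>R v) - g (x + a *\<^sub>R u)) \<bullet> (h *\<^sub>R u)) (t - 0)"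
        by (rule mvt_simple[OF \<open>0 < t\<close>]) (simp add: der has_derivative_at_withinI del: inner_scaleR_right)
      then show ?thesis using that by auto
    qed
    \<comment> \<open>Difference of the linearisation errors of \<open>g\<close> at the two ends of
      the increment. The contributions of \<open>a *\<^sub>R u\<close> cancel and leave
      \<open>t *\<^sub>R H v\<close>; the term \<open>0 *\<^sub>R v\<close> gives both errors the
      shape of \<open>gest\<close>.\<close>
    let ?R = "(g (x + a *\<^sub>R u + t *\<^sub>R v) - g x - H (a *\<^sub>R u + t *\<^sub>R v)) -
              (g (x + a *\<^sub>R u + 0 *\<^sub>R v) - g x - H (a *\<^sub>R u + 0 *\<^sub>R v))"
    have normR: "norm ?R \<le> k * (t * N) + k * (t * N)"
      by (rule order_trans[OF norm_triangle_ineq4 add_mono[OF gest gest]]) (use a t in auto)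
    have R: "g (x + a *\<^sub>R u + t *\<^sub>R v) - g (x + a *\<^sub>R u) = t *\<^sub>R H v + ?R"
      by (simp add: H.add H.scaleR)
    have "\<bar>?R \<bullet> u\<bar> \<le> norm ?R * norm u" by (rule Cauchy_Schwarz_ineq2)
    also have "\<dots> \<le> (k * (t * N) + k * (t * N)) * norm u"
      by (rule mult_right_mono[OF normR norm_ge_zero])
    also have "\<dots> = (2 * k * t * N) * norm u" by simp
    also have "\<dots> \<le> (2 * k * t * N) * N"
      using k t N by (intro mult_left_mono) (auto simp: N_def)
    also have "\<dots> = t * (e / 2)" using N by (simp add: k_def power2_eq_square field_simps)
    finally have Ru: "\<bar>?R \<bullet> u\<bar> \<le> t * (e / 2)" .
    have "f (x + t *\<^sub>R u + t *\<^sub>R v) - f (x + t *\<^sub>R u) - f (x + t *\<^sub>R v) + f x = \<phi> t - \<phi> 0"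
      by (simp add: \<phi>_def)
    also have "\<dots> = t\<^sup>2 * (H v \<bullet> u) + t * (?R \<bullet> u)"
      unfolding mv R by (simp add: inner_add_left algebra_simps power2_eq_square)
    finally have "(f (x + t *\<^sub>R u + t *\<^sub>R v) - f (x + t *\<^sub>R u) - f (x + t *\<^sub>R v) + f x) / t\<^sup>2
        - H v \<bullet> u = (?R \<bullet> u) / t"
      using t by (simp add: power2_eq_square field_simps)
    then have "dist ((f (x + t *\<^sub>R u + t *\<^sub>R v) - f (x + t *\<^sub>R u) - f (x + t *\<^sub>R v) + f x) / t\<^sup>2)
        (H v \<bullet> u) = \<bar>?R \<bullet> u\<bar> / t"
      using t by (simp add: dist_real_def)
    also have "\<dots> \<le> e / 2" using Ru t by (simp add: field_simps)
    also have "\<dots> < e" using \<open>e > 0\<close> by simp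
    finally show "dist ((f (x + t *\<^sub>R u + t *\<^sub>R v) - f (x + t *\<^sub>R u) - f (x + t *\<^sub>R v) + f x) / t\<^sup>2)
        (H v \<bullet> u) < e" .
  qed
qed

lemma second_derivative_symmetric:
  fixes f :: "'a::real_inner \<Rightarrow> real" and g :: "'a \<Rightarrow> 'a"
  assumes "open U" "x \<in> U"
    and "\<And>y. y \<in> U \<Longrightarrow> (f has_derivative (\<lambda>h. g y \<bullet> h)) (at y)"
    and "(g has_derivative H) (at x)"
  shows "H u \<bullet> v = H v \<bullet> u"
proof -
  let ?q = "\<lambda>u v t. (f (x + t *\<^sub>R u + t *\<^sub>R v) - f (x + t *\<^sub>R u) - f (x + t *\<^sub>R v) + f x) / t\<^sup>2"
  have "?q u v = ?q v u" by (simp add: fun_eq_iff algebra_simps)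
  then have "(?q u v \<longlongrightarrow> H u \<bullet> v) (at_right 0)"
    using second_difference_quotient_tendsto[OF assms, of v u] by metis
  then show ?thesis
    using second_difference_quotient_tendsto[OF assms, of u v]
    by (intro tendsto_unique[OF trivial_limit_at_right_real])
qed

section \<open>The tangent space of a level set\<close>

text \<open>The map \<open>y \<mapsto> y - (y \<bullet> n) n + f y n\<close>, with \<open>n\<close> the unit normal at \<open>x\<close>, straightens the
  level sets of \<open>f\<close> near \<open>x\<close> into hyperplanes orthogonal to \<open>n\<close>; its local inverse turns line
  segments into the required curves.\<close>

lemma tangent_space_level_set:
  fixes f :: "real^'n \<Rightarrow> real" and g :: "real^'n \<Rightarrow> real^'n"
  assumes U: "open U" "x \<in> U"
    and f: "\<And>y. y \<in> U \<Longrightarrow> (f has_derivative (\<lambda>h. g y \<bullet> h)) (at y)"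
    and g: "continuous_on U g" and gx: "g x \<noteq> 0"
  shows "tangent_space (level_set U f x) x = {v. g x \<bullet> v = 0}"
proof (intro set_eqI iffI)
  fix v assume "v \<in> tangent_space (level_set U f x) x"
  then obtain \<gamma> e where e: "0 < e" and sub: "\<gamma> ` {-e<..<e} \<subseteq> level_set U f x" and
    \<gamma>: "\<gamma> 0 = x" "(\<gamma> has_vector_derivative v) (at 0)"
    unfolding tangent_space_def mem_Collect_eq by (elim exE conjE) (rule that)
  have "((\<lambda>t. f (\<gamma> t)) has_derivative (\<lambda>h. g x \<bullet> (h *\<^sub>R v))) (at 0)"
    using \<gamma> f[OF U(2)]
    by (intro has_derivative_compose[where f = \<gamma> and g = f]) (simp_all add: has_vector_derivative_def)
  moreover have "((\<lambda>t. f (\<gamma> t)) has_derivative (\<lambda>h. 0)) (at 0)"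
    by (rule has_derivative_transform_within_open[of "\<lambda>t. f x" _ _ _ "{-e<..<e}"])
      (use e sub in \<open>auto simp: level_set_def image_subset_iff\<close>)
  ultimately have "(\<lambda>h. g x \<bullet> (h *\<^sub>R v)) = (\<lambda>h::real. 0)" by (rule has_derivative_unique)
  from fun_cong[OF this, of 1] show "v \<in> {v. g x \<bullet> v = 0}" by simp
next
  fix v assume "v \<in> {v. g x \<bullet> v = 0}"
  then have v: "g x \<bullet> v = 0" by simp
  define s where "s = norm (g x)"
  define n where "n = g x /\<^sub>R s"
  have s: "s > 0" using gx by (simp add: s_def)
  have gs: "g x = s *\<^sub>R n" using s by (simp add: n_def)
  have nn: "n \<bullet> n = 1" using s by (simp add: n_def s_def dot_square_norm power2_eq_square)
  have nv: "n \<bullet> v = 0" using v by (simp add: n_def)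
  define \<Phi> where "\<Phi> = (\<lambda>y. y - (y \<bullet> n) *\<^sub>R n + f y *\<^sub>R n)"
  \<comment> \<open>\<open>D y\<close> is the derivative of \<Phi> at \<open>y\<close>. At
    \<open>x\<close> it multiplies the \<open>n\<close>-component by \<open>s\<close> and fixes the
    orthogonal complement, so \<open>E\<close>, which multiplies that component by
    \<open>1 / s\<close>, inverts it.\<close>
  define D where "D = (\<lambda>y. Blinfun (\<lambda>h. h + ((g y - n) \<bullet> h) *\<^sub>R n))"
  define E where "E = Blinfun (\<lambda>h. h + ((1 / s - 1) * (n \<bullet> h)) *\<^sub>R n)"
  have D: "blinfun_apply (D y) = (\<lambda>h. h + ((g y - n) \<bullet> h) *\<^sub>R n)" for y
    unfolding D_def by (intro bounded_linear_Blinfun_apply bounded_linear_intros)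
  have E: "blinfun_apply E = (\<lambda>h. h + ((1 / s - 1) * (n \<bullet> h)) *\<^sub>R n)"
    unfolding E_def by (intro bounded_linear_Blinfun_apply bounded_linear_intros)
  have der: "(\<Phi> has_derivative blinfun_apply (D y)) (at y)" if "y \<in> U" for y
    unfolding \<Phi>_def D
    by (rule derivative_eq_intros f[OF that] refl)+
      (auto simp: algebra_simps inner_commute fun_eq_iff)
  have cont: "continuous_on U D"
    by (intro continuous_on_blinfun_componentwise) (auto simp: D intro!: continuous_intros g)
  have inv: "E o\<^sub>L D x = id_blinfun"
  proof (rule blinfun_eqI)
    fix h
    have "n \<bullet> (D x h) = s * (n \<bullet> h)"
      by (simp add: D gs inner_simps nn algebra_simps)
    then have "E (D x h) = D x h + ((1 / s - 1) * (s * (n \<bullet> h))) *\<^sub>R n"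
      by (simp add: E)
    also have "(1 / s - 1) * (s * (n \<bullet> h)) = (1 - s) * (n \<bullet> h)"
      using s by (simp add: field_simps)
    also have "D x h + ((1 - s) * (n \<bullet> h)) *\<^sub>R n = h"
      by (simp add: D gs inner_simps algebra_simps)
    finally show "blinfun_apply (E o\<^sub>L D x) h = blinfun_apply id_blinfun h" by simp
  qed
  obtain U' V \<Psi> \<Psi>' where V: "open U'" "U' \<subseteq> U" "x \<in> U'" "open V" "\<Phi> x \<in> V"
    and hom: "homeomorphism U' V \<Phi> \<Psi>"
    and d\<Psi>: "\<And>y. y \<in> V \<Longrightarrow> (\<Psi> has_derivative \<Psi>' y) (at y)"
    and \<Psi>': "\<And>y. y \<in> V \<Longrightarrow> \<Psi>' y = Hilbert_Choice.inv (blinfun_apply (D (\<Psi> y)))"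
    and bij: "\<And>y. y \<in> V \<Longrightarrow> bij (blinfun_apply (D (\<Psi> y)))"
    using inverse_function_theorem[OF U(1) der cont U(2) inv] by blast
  define \<gamma> where "\<gamma> = (\<lambda>t::real. \<Psi> (\<Phi> x + t *\<^sub>R v))"
  have "open ((\<lambda>t::real. \<Phi> x + t *\<^sub>R v) -` V)"
    by (intro open_vimage V continuous_intros)
  moreover have "0 \<in> (\<lambda>t::real. \<Phi> x + t *\<^sub>R v) -` V" using V by simp
  ultimately obtain e where e: "e > 0" "ball 0 e \<subseteq> (\<lambda>t::real. \<Phi> x + t *\<^sub>R v) -` V"
    using open_contains_ball by blast
  have inV: "\<Phi> x + t *\<^sub>R v \<in> V" if "t \<in> {-e<..<e}" for t
    using e that by (auto simp: dist_real_def subset_iff)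
  have \<gamma>U: "\<gamma> t \<in> U" if "t \<in> {-e<..<e}" for t
    using inV[OF that] hom V(2) unfolding \<gamma>_def homeomorphism_def by blast
  \<comment> \<open>The \<open>n\<close>-component of \<open>\<Phi> y\<close> is \<open>f y\<close>,
    and moving along \<open>v\<close>, orthogonal to \<open>n\<close>, does not change it.\<close>
  have level: "\<gamma> t \<in> level_set U f x" if "t \<in> {-e<..<e}" for t
  proof -
    have *: "n \<bullet> \<Phi> y = f y" for y by (simp add: \<Phi>_def inner_simps nn inner_commute)
    have "\<Phi> (\<gamma> t) = \<Phi> x + t *\<^sub>R v"
      using inV[OF that] hom unfolding \<gamma>_def homeomorphism_def by blast
    then have "n \<bullet> \<Phi> (\<gamma> t) = n \<bullet> \<Phi> x" by (simp add: inner_simps nv)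
    then show ?thesis using \<gamma>U[OF that] by (simp add: * level_set_def)
  qed
  \<comment> \<open>The solution of \<open>D (\<gamma> t) z = v\<close>: the equation forces
    \<open>z = v - c *\<^sub>R n\<close>, and its \<open>n\<close>-component reads
    \<open>g (\<gamma> t) \<bullet> z = 0\<close>, which determines \<open>c\<close>. The explicit
    formula makes continuity of the velocity visible.\<close>
  define \<gamma>' where "\<gamma>' = (\<lambda>t. v - ((g (\<gamma> t) \<bullet> v) / (g (\<gamma> t) \<bullet> n)) *\<^sub>R n)"
  \<comment> \<open>\<open>D (\<gamma> t)\<close> sends \<open>n\<close> to
    \<open>(g (\<gamma> t) \<bullet> n) *\<^sub>R n\<close>, so a zero would contradict its
    injectivity.\<close>
  have nz: "g (\<gamma> t) \<bullet> n \<noteq> 0" if "t \<in> {-e<..<e}" for t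
  proof
    assume "g (\<gamma> t) \<bullet> n = 0"
    then have "D (\<gamma> t) n = D (\<gamma> t) 0" by (simp add: D inner_simps nn)
    then have "n = 0" using bij[OF inV[OF that]] unfolding \<gamma>_def bij_def inj_def by blast
    then show False using nn by simp
  qed
  have d\<gamma>: "(\<gamma> has_vector_derivative \<gamma>' t) (at t)" if t: "t \<in> {-e<..<e}" for t
  proof -
    let ?y = "\<Phi> x + t *\<^sub>R v"
    have lin: "linear (\<Psi>' ?y)" using d\<Psi>[OF inV[OF t]] by (rule has_derivative_linear)
    have "(\<gamma> has_derivative (\<lambda>h. \<Psi>' ?y (h *\<^sub>R v))) (at t)"
      unfolding \<gamma>_def
      by (rule has_derivative_compose[where g = \<Psi>])
        (use d\<Psi>[OF inV[OF t]] in \<open>auto intro!: derivative_eq_intros\<close>)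
    then have *: "(\<gamma> has_vector_derivative \<Psi>' ?y v) (at t)"
      by (simp add: has_vector_derivative_def linear_scale[OF lin])
    have "D (\<gamma> t) (\<gamma>' t) = v"
      using nz[OF t] by (simp add: D \<gamma>'_def inner_simps nn nv algebra_simps)
    then have "\<Psi>' ?y v = \<gamma>' t"
      unfolding \<Psi>'[OF inV[OF t]] using bij[OF inV[OF t]]
      by (intro inv_f_eq) (auto simp: \<gamma>_def bij_def)
    then show ?thesis using * by simp
  qed
  have c\<gamma>: "continuous_on {-e<..<e} \<gamma>"
    using d\<gamma> has_vector_derivative_continuous
    by (meson continuous_at_imp_continuous_on)
  have "continuous_on {-e<..<e} \<gamma>'" unfolding \<gamma>'_def
    by (intro continuous_intros continuous_on_compose2[OF g c\<gamma>]) (use nz \<gamma>U in auto)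
  then have C1: "\<gamma> C1_differentiable_on {-e<..<e}"
    unfolding C1_differentiable_on_def using d\<gamma> by blast
  have \<gamma>0: "\<gamma> 0 = x" using hom V(3) by (simp add: \<gamma>_def homeomorphism_def)
  have "\<gamma>' 0 = v" by (simp add: \<gamma>'_def \<gamma>0 v)
  then have \<gamma>v: "(\<gamma> has_vector_derivative v) (at 0)" using d\<gamma>[of 0] e by simp
  have "\<gamma> ` {-e<..<e} \<subseteq> level_set U f x" using level by blast
  then show "v \<in> tangent_space (level_set U f x) x"
    unfolding tangent_space_def mem_Collect_eq using e(1) C1 \<gamma>0 \<gamma>v by (intro exI conjI)
qed

section \<open>Gradients and tangential gradients\<close>

lemma has_derivative_grad:
  assumes "f differentiable (at x)"
  shows "(f has_derivative (\<lambda>h. grad f x \<bullet> h)) (at x)"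
proof -
  have d: "(f has_derivative frechet_derivative f (at x)) (at x)"
    using assms frechet_derivative_works by blast
  have "frechet_derivative f (at x) h = grad f x \<bullet> h" for h
  proof -
    have "frechet_derivative f (at x) h = frechet_derivative f (at x) (\<Sum>i\<in>UNIV. h $ i *\<^sub>R axis i 1)"
      by (simp add: basis_expansion flip: scalar_mult_eq_scaleR)
    also have "\<dots> = (\<Sum>i\<in>UNIV. h $ i * frechet_derivative f (at x) (axis i 1))"
      using has_derivative_linear[OF d] by (simp add: linear_sum linear_scale)
    finally show ?thesis by (simp add: inner_vec_def grad_def mult.commute)
  qed
  then show ?thesis using d by (metis (no_types, lifting) ext)
qed

lemma grad_eqI:
  assumes "(f has_derivative (\<lambda>h. a \<bullet> h)) (at x)"
  shows "grad f x = a"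
  by (simp add: grad_def frechet_derivative_at[OF assms, symmetric] vec_eq_iff inner_axis)

text \<open>The description in \<open>tangential_grad_def\<close> needs uniqueness: the difference
  of two representing vectors lies in the hyperplane and is orthogonal to all of it, hence to
  itself.\<close>

lemma tangential_grad_hyperplane:
  assumes f: "f differentiable (at x)" and n: "norm n = 1"
  shows "tangential_grad {v. n \<bullet> v = 0} f x = grad f x - (grad f x \<bullet> n) *\<^sub>R n"
    (is "_ = ?g")
proof -
  have nn: "n \<bullet> n = 1" using n by (simp add: dot_square_norm)
  have fd: "frechet_derivative f (at x) = (\<lambda>h. grad f x \<bullet> h)"
    using frechet_derivative_at[OF has_derivative_grad[OF f]] by simp
  have g: "?g \<in> {v. n \<bullet> v = 0} \<and> (\<forall>\<tau>\<in>{v. n \<bullet> v = 0}. ?g \<bullet> \<tau> = grad f x \<bullet> \<tau>)"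
    by (simp add: inner_simps nn inner_commute)
  show ?thesis unfolding tangential_grad_def fd
  proof (rule the_equality)
    show "?g \<in> {v. n \<bullet> v = 0} \<and> (\<forall>\<tau>\<in>{v. n \<bullet> v = 0}. ?g \<bullet> \<tau> = grad f x \<bullet> \<tau>)"
      by (rule g)
  next
    fix h assume h: "h \<in> {v. n \<bullet> v = 0} \<and> (\<forall>\<tau>\<in>{v. n \<bullet> v = 0}. h \<bullet> \<tau> = grad f x \<bullet> \<tau>)"
    have d: "n \<bullet> (h - ?g) = 0" using h by (simp add: inner_simps nn inner_commute)
    then have "h \<bullet> (h - ?g) = ?g \<bullet> (h - ?g)" using h g by auto
    then have "(h - ?g) \<bullet> (h - ?g) = 0" by (simp only: inner_diff_left)
    then show "h = ?g" by simp
  qed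
qed

section \<open>Positive semidefiniteness of scalar and block diagonal matrices\<close>

lemma psd_mat: "psd (mat k :: real^'n^'n) \<longleftrightarrow> 0 \<le> k"
proof -
  have e: "v \<bullet> ((mat k :: real^'n^'n) *v v) = k * (v \<bullet> v)" for v :: "real^'n"
    by (simp add: inner_vec_def matrix_vector_mult_def mat_def if_distrib if_distribR
        sum_distrib_left algebra_simps cong: if_cong)
  have "0 \<le> k" if "\<forall>v::real^'n. 0 \<le> k * (v \<bullet> v)"
    using that[rule_format, of "axis undefined 1"] by (simp add: inner_axis_axis)
  then show ?thesis by (auto simp: psd_def transpose_mat e)
qed

text \<open>At \<open>\<tau> + a *\<^sub>R \<nu>\<close> the mixed terms of the quadratic form
  vanish, leaving \<open>\<beta> \<tau> \<tau> + a * a * c\<close>.\<close>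

lemma psd_block_diagonal:
  assumes B: "block_diagonal T \<nu> B \<beta> c" and sym: "transpose B = B"
  shows "psd B \<longleftrightarrow> (\<forall>\<tau>\<in>T. 0 \<le> \<beta> \<tau> \<tau>) \<and> 0 \<le> c"
proof
  assume "psd B"
  then show "(\<forall>\<tau>\<in>T. 0 \<le> \<beta> \<tau> \<tau>) \<and> 0 \<le> c"
    using B unfolding psd_def block_diagonal_def by metis
next
  assume *: "(\<forall>\<tau>\<in>T. 0 \<le> \<beta> \<tau> \<tau>) \<and> 0 \<le> c"
  have "0 \<le> z \<bullet> (B *v z)" for z
  proof -
    obtain \<tau> a where z: "\<tau> \<in> T" "z = \<tau> + a *\<^sub>R \<nu>"
      using B unfolding block_diagonal_def by blast
    have "z \<bullet> (B *v z) = \<tau> \<bullet> (B *v \<tau>) + a * (\<tau> \<bullet> (B *v \<nu>)) + a * (\<nu> \<bullet> (B *v \<tau>))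
        + a * a * (\<nu> \<bullet> (B *v \<nu>))"
      by (simp add: z matrix_vector_right_distrib matrix_vector_mult_scaleR inner_simps algebra_simps)
    also have "\<dots> = \<beta> \<tau> \<tau> + a * a * c"
      using B z unfolding block_diagonal_def by simp
    finally show ?thesis using * z by simp
  qed
  then show "psd B" using sym by (simp add: psd_def)
qed

lemma transpose_eq_selfI:
  fixes B :: "real^'n^'n"
  assumes "\<And>u v. u \<bullet> (B *v v) = v \<bullet> (B *v u)"
  shows "transpose B = B"
proof -
  have "(transpose B *v v) \<bullet> u = (B *v v) \<bullet> u" for u v
    by (metis assms dot_lmul_matrix inner_commute transpose_matrix_vector)
  then show ?thesis by (metis matrix_eq vector_eq_rdot)
qed

lemma transpose_Mp: "transpose (Mp p w x) = Mp p w x"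
proof -
  have "Mp p w x $ j $ i = Mp p w x $ i $ j" for i j
    by (simp only: Mp_def transpose_def vector_add_component vector_scaleR_component
        vec_lambda_beta add.commute)
  then show ?thesis unfolding transpose_def vec_eq_iff vec_lambda_beta by blast
qed

section \<open>Slope, second fundamental form and flux at a noncritical point\<close>

context
  fixes U :: "(real^'n) set" and w :: "real^'n \<Rightarrow> real" and x :: "real^'n"
  assumes U: "open U" and C2: "C2_on U w" and xU: "x \<in> U" and grad_nz: "grad w x \<noteq> 0"
begin

lemma slope_pos: "0 < slope w x"
  using grad_nz by (simp add: slope_def)

lemma norm_unit_normal: "norm (unit_normal w x) = 1"
  using slope_pos by (simp add: unit_normal_def slope_def)

lemma grad_eq_slope_normal: "grad w x = slope w x *\<^sub>R unit_normal w x"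
  using slope_pos by (simp add: unit_normal_def)

lemma has_derivative_w: "y \<in> U \<Longrightarrow> (w has_derivative (\<lambda>h. grad w y \<bullet> h)) (at y)"
  using C2 by (intro has_derivative_grad) (simp add: C2_on_def)

lemma has_derivative_grad_w: "y \<in> U \<Longrightarrow> (grad w has_derivative (\<lambda>h. hessian w y *v h)) (at y)"
  using C2 by (simp add: C2_on_def hessian_def flip: jacobian_works)

lemma hessian_symmetric: "u \<bullet> (hessian w x *v v) = v \<bullet> (hessian w x *v u)"
  using second_derivative_symmetric[OF U xU has_derivative_w has_derivative_grad_w[OF xU], of v u]
  by (simp add: inner_commute)

lemma continuous_on_grad_w: "continuous_on U (grad w)"
  using has_derivative_grad_w has_derivative_continuous
  by (meson continuous_at_imp_continuous_on)

lemma tangent_space_eq: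
  "tangent_space (level_set U w x) x = {v. unit_normal w x \<bullet> v = 0}"
  using tangent_space_level_set[OF U xU has_derivative_w continuous_on_grad_w grad_nz] slope_pos
  by (simp add: grad_eq_slope_normal)

lemma has_derivative_slope:
  "(slope w has_derivative (\<lambda>h. unit_normal w x \<bullet> (hessian w x *v h))) (at x)"
  unfolding slope_def
  by (rule has_derivative_eq_rhs
        [OF has_derivative_compose[OF has_derivative_grad_w[OF xU] has_derivative_norm[OF grad_nz]]])
    (simp add: unit_normal_def slope_def sgn_div_norm inner_commute)

text \<open>The derivative of the slope pairs \<nu> with the Hessian applied to the increment;
  symmetry moves the Hessian onto \<nu>.\<close>

lemma grad_slope: "grad (slope w) x = hessian w x *v unit_normal w x"
proof (rule grad_eqI)
  have "(\<lambda>h. unit_normal w x \<bullet> (hessian w x *v h)) = (\<lambda>h. (hessian w x *v unit_normal w x) \<bullet> h)"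
    using hessian_symmetric by (simp add: inner_commute fun_eq_iff)
  then show "(slope w has_derivative (\<lambda>h. (hessian w x *v unit_normal w x) \<bullet> h)) (at x)"
    using has_derivative_slope by simp
qed

text \<open>By the quotient rule the derivative of the unit normal is the Hessian divided by the
  slope, minus a multiple of the normal; that multiple disappears against a tangent \<eta>.\<close>

lemma second_fundamental_form_eq:
  assumes "unit_normal w x \<bullet> \<eta> = 0"
  shows "slope w x * second_fundamental_form w x \<tau> \<eta> = (hessian w x *v \<tau>) \<bullet> \<eta>"
proof -
  let ?n = "unit_normal w x" and ?H = "hessian w x" and ?s = "slope w x"
  have "((\<lambda>y. grad w y /\<^sub>R slope w y) has_derivative
      (\<lambda>h. (?H *v h) /\<^sub>R ?s - ((?n \<bullet> (?H *v h)) / ?s) *\<^sub>R ?n)) (at x)"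
    using slope_pos
    by (auto intro!: derivative_eq_intros has_derivative_slope has_derivative_grad_w xU
        simp: unit_normal_def fun_eq_iff field_simps)
  then have "(unit_normal w has_derivative
      (\<lambda>h. (?H *v h) /\<^sub>R ?s - ((?n \<bullet> (?H *v h)) / ?s) *\<^sub>R ?n)) (at x)"
    by (simp add: unit_normal_def[abs_def])
  from frechet_derivative_at[OF this, symmetric]
  show ?thesis using slope_pos assms
    by (simp add: second_fundamental_form_def inner_simps)
qed

text \<open>Product rule: differentiating the power yields a factor \<open>(p - 2) / s\<close>, and
  writing the gradient as \<open>s\<close> times the unit normal cancels the denominator.\<close>

lemma jacobian_flux:
  "jacobian (flux p w) (at x) *v v = slope w x powr (p - 2) *\<^sub>R
     (hessian w x *v v + ((p - 2) * (unit_normal w x \<bullet> (hessian w x *v v))) *\<^sub>R unit_normal w x)"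
proof -
  let ?n = "unit_normal w x" and ?H = "hessian w x" and ?s = "slope w x"
  have "((\<lambda>y. slope w y powr (p - 2)) has_derivative
      (\<lambda>h. ?s powr (p - 2) * ((p - 2) * (?n \<bullet> (?H *v h)) / ?s))) (at x)"
    by (rule has_derivative_eq_rhs[OF has_derivative_powr[OF has_derivative_slope has_derivative_const]])
      (use slope_pos in auto)
  from has_derivative_scaleR[OF this has_derivative_grad_w[OF xU]]
  have "((\<lambda>y. slope w y powr (p - 2) *\<^sub>R grad w y) has_derivative
      (\<lambda>h. ?s powr (p - 2) *\<^sub>R (?H *v h + ((p - 2) * (?n \<bullet> (?H *v h))) *\<^sub>R ?n))) (at x)"
    by (rule has_derivative_eq_rhs)
      (use slope_pos in \<open>auto simp: fun_eq_iff grad_eq_slope_normal scaleR_add_right\<close>)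
  then have *: "(flux p w has_derivative
      (\<lambda>h. ?s powr (p - 2) *\<^sub>R (?H *v h + ((p - 2) * (?n \<bullet> (?H *v h))) *\<^sub>R ?n))) (at x)"
    by (simp add: flux_def[abs_def] slope_def)
  then have "(flux p w has_derivative (\<lambda>h. jacobian (flux p w) (at x) *v h)) (at x)"
    using jacobian_works differentiableI by blast
  from fun_cong[OF has_derivative_unique[OF this *]] show ?thesis .
qed

text \<open>The bilinear form is the mean of \<open>u \<bullet> (J v)\<close> and
  \<open>v \<bullet> (J u)\<close> for the Jacobian \<open>J\<close> of the flux. The Hessian term
  is already symmetric; only the rank-one term gets symmetrised.\<close>

lemma inner_Mp:
  "u \<bullet> (Mp p w x *v v) = slope w x powr (p - 2) * (u \<bullet> (hessian w x *v v) + (p - 2) / 2 *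
     ((unit_normal w x \<bullet> (hessian w x *v v)) * (unit_normal w x \<bullet> u) +
      (unit_normal w x \<bullet> (hessian w x *v u)) * (unit_normal w x \<bullet> v)))"
proof -
  let ?J = "jacobian (flux p w) (at x)"
  have "u \<bullet> (Mp p w x *v v) = (u \<bullet> (?J *v v) + v \<bullet> (?J *v u)) / 2"
    by (simp add: Mp_def scaleR_matrix_vector_assoc[symmetric] matrix_vector_mult_add_rdistrib
        inner_add_right transpose_matrix_vector dot_lmul_matrix inner_commute[of u "_ v* _"])
  then show ?thesis
    using hessian_symmetric[of u v]
    by (simp add: jacobian_flux inner_simps inner_commute field_simps)
qed

section \<open>The cases p = 2 and N = 1\<close>

lemma Mp_2: "Mp 2 w x = hessian w x"
proof -
  have "u \<bullet> (Mp 2 w x *v v) = u \<bullet> (hessian w x *v v)" for u v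
    \<comment> \<open>Positivity of the slope matters, since \<open>0 powr 0 = 0\<close>.\<close>
    using slope_pos by (simp add: inner_Mp)
  then show ?thesis by (metis matrix_eq vector_eq_ldot)
qed

text \<open>With a single index, \<open>vec\<close> is a linear identification of the reals with the
  whole space, so the chain rule translates ordinary derivatives into gradient and Hessian
  entries.\<close>

lemma deriv_line_1:
  assumes N: "CARD('n) = 1"
  shows "deriv (\<lambda>t. w (vec t)) (x $ i) = grad w x $ i"
    and "deriv (deriv (\<lambda>t. w (vec t))) (x $ i) = hessian w x $ i $ i"
proof -
  have eq: "j = i" for j :: 'n
    using N card_1_singletonE[of "UNIV :: 'n set"] by (metis UNIV_I singletonD)
  have vx: "vec (x $ i) = x" by (simp add: vec_eq_iff) (metis eq)
  have axis: "vec h = h *\<^sub>R axis i (1::real)" for h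
    by (simp add: vec_eq_iff axis_def) (metis eq)
  have dvec: "((vec :: real \<Rightarrow> real^'n) has_derivative vec) (at t)" for t
  proof (rule bounded_linear_imp_has_derivative)
    have "linear (vec :: real \<Rightarrow> real^'n)" by (rule linearI) (simp_all add: vec_eq_iff)
    then show "bounded_linear (vec :: real \<Rightarrow> real^'n)" by (simp add: linear_conv_bounded_linear)
  qed
  have 1: "((\<lambda>t. w (vec t)) has_field_derivative grad w (vec t) $ i) (at t)" if "vec t \<in> U" for t
    unfolding has_field_derivative_def
    by (rule has_derivative_eq_rhs[OF has_derivative_compose[OF dvec has_derivative_w[OF that]]])
      (simp add: axis inner_axis fun_eq_iff mult.commute)
  show "deriv (\<lambda>t. w (vec t)) (x $ i) = grad w x $ i"
    using DERIV_imp_deriv[OF 1, of "x $ i"] vx xU by simp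
  \<comment> \<open>The outer \<open>deriv\<close> needs the inner one identified on a neighbourhood
    of \<open>x $ i\<close>, not just at that point.\<close>
  have "open ((vec :: real \<Rightarrow> real^'n) -` U)"
    using U has_derivative_continuous[OF dvec] by (intro open_vimage) (auto simp: continuous_on_eq_continuous_at)
  then have "\<forall>\<^sub>F t in nhds (x $ i). vec t \<in> U"
    using vx xU eventually_nhds_in_open[of "vec -` U" "x $ i"] by simp
  then have ev: "\<forall>\<^sub>F t in nhds (x $ i). deriv (\<lambda>t. w (vec t)) t = grad w (vec t) $ i"
    by eventually_elim (use 1 DERIV_imp_deriv in blast)
  have "((\<lambda>t. grad w (vec t)) has_derivative (\<lambda>h. hessian w x *v vec h)) (at (x $ i))"
    using has_derivative_compose[OF dvec, of "grad w" _ "x $ i"] has_derivative_grad_w[OF xU] vx by simp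
  then have "((\<lambda>t. grad w (vec t) $ i) has_derivative (\<lambda>h. (hessian w x *v vec h) $ i)) (at (x $ i))"
    by (rule bounded_linear.has_derivative[OF bounded_linear_vec_nth])
  moreover have "(hessian w x *v vec h) $ i = hessian w x $ i $ i * h" for h
    by (simp add: axis matrix_vector_mult_scaleR matrix_vector_mul_component inner_axis)
  ultimately have "((\<lambda>t. grad w (vec t) $ i) has_field_derivative hessian w x $ i $ i) (at (x $ i))"
    by (simp add: has_field_derivative_def)
  then show "deriv (deriv (\<lambda>t. w (vec t))) (x $ i) = hessian w x $ i $ i"
    using deriv_cong_ev[OF ev refl] DERIV_imp_deriv by metis
qed

text \<open>The only component of the unit normal squares to 1, so the rank-one term is
  \<open>p - 2\<close> times the Hessian entry and the coefficients add up to
  \<open>p - 1\<close>.\<close>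

lemma Mp_dim_1:
  assumes N: "CARD('n) = 1"
  shows "Mp p w x = mat ((p - 1) * \<bar>grad w x $ i\<bar> powr (p - 2) * hessian w x $ i $ i)"
proof -
  let ?n = "unit_normal w x" and ?h = "hessian w x $ i $ i"
  have eq: "j = i" for j :: 'n
    using N card_1_singletonE[of "UNIV :: 'n set"] by (metis UNIV_I singletonD)
  have UN: "(UNIV :: 'n set) = {i}" using eq by auto
  have s: "slope w x = \<bar>grad w x $ i\<bar>" by (simp add: slope_def norm_vec_def L2_set_def UN)
  have "?n $ i * ?n $ i = ?n \<bullet> ?n" by (simp add: inner_vec_def UN)
  then have nn: "?n $ i * ?n $ i = 1" using norm_unit_normal by (simp add: dot_square_norm)
  have entry: "axis i 1 \<bullet> (B *v axis i 1) = B $ i $ i" for B :: "real^'n^'n"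
    by (simp add: inner_axis' matrix_vector_mul_component inner_axis)
  have nH: "?n \<bullet> (hessian w x *v axis i 1) = ?n $ i * ?h"
    by (simp add: inner_vec_def UN matrix_vector_mul_component axis_def)
  have "Mp p w x $ i $ i = \<bar>grad w x $ i\<bar> powr (p - 2) * (?h + (p - 2) * ((?n $ i * ?n $ i) * ?h))"
    unfolding entry[symmetric] inner_Mp s[symmetric] nH by (simp add: entry inner_axis field_simps)
  also have "\<dots> = (p - 1) * \<bar>grad w x $ i\<bar> powr (p - 2) * ?h"
    unfolding nn by (simp add: algebra_simps)
  finally show ?thesis by (simp add: vec_eq_iff mat_def) (metis eq)
qed

section \<open>Block form when the tangential gradient of the slope vanishes\<close>

text \<open>The gradient of the slope is the Hessian applied to \<nu>; with zero tangential part it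
  is a multiple of \<nu>, and symmetry transfers the orthogonality to tangent vectors.\<close>

lemma hessian_normal_tangent:
  assumes "tangential_grad (tangent_space (level_set U w x) x) (slope w) x = 0"
    and "unit_normal w x \<bullet> \<tau> = 0"
  shows "unit_normal w x \<bullet> (hessian w x *v \<tau>) = 0"
proof -
  let ?n = "unit_normal w x"
  have "slope w differentiable (at x)" using has_derivative_slope differentiableI by blast
  from tangential_grad_hyperplane[OF this norm_unit_normal] assms(1)
  have "hessian w x *v ?n = ((hessian w x *v ?n) \<bullet> ?n) *\<^sub>R ?n"
    by (simp add: tangent_space_eq grad_slope)
  then have "\<tau> \<bullet> (hessian w x *v ?n) = ((hessian w x *v ?n) \<bullet> ?n) * (\<tau> \<bullet> ?n)"
    by (metis inner_scaleR_right)
  then show ?thesis using assms(2) hessian_symmetric[of \<tau> ?n] by (simp add: inner_commute)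
qed

text \<open>Settles the orthogonal decomposition once for both matrices, so that only their entries
  remain to be computed.\<close>

lemma block_diagonal_normal:
  fixes B :: "real^'n^'n"
  assumes "\<And>\<tau> \<eta>. unit_normal w x \<bullet> \<tau> = 0 \<Longrightarrow> unit_normal w x \<bullet> \<eta> = 0 \<Longrightarrow> \<tau> \<bullet> (B *v \<eta>) = \<beta> \<tau> \<eta>"
    and "\<And>\<tau>. unit_normal w x \<bullet> \<tau> = 0 \<Longrightarrow> \<tau> \<bullet> (B *v unit_normal w x) = 0"
    and "\<And>\<tau>. unit_normal w x \<bullet> \<tau> = 0 \<Longrightarrow> unit_normal w x \<bullet> (B *v \<tau>) = 0"
    and "unit_normal w x \<bullet> (B *v unit_normal w x) = c"
  shows "block_diagonal (tangent_space (level_set U w x) x) (unit_normal w x) B \<beta> c"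
proof -
  let ?n = "unit_normal w x"
  have nn: "?n \<bullet> ?n = 1" using norm_unit_normal by (simp add: dot_square_norm)
  have "\<exists>\<tau>\<in>{v. ?n \<bullet> v = 0}. \<exists>a. z = \<tau> + a *\<^sub>R ?n" for z
    by (rule bexI[of _ "z - (?n \<bullet> z) *\<^sub>R ?n"], rule exI[of _ "?n \<bullet> z"])
      (simp_all add: inner_simps nn)
  then show ?thesis
    using assms norm_unit_normal
    by (simp add: block_diagonal_def tangent_space_eq subspace_hyperplane2 orthogonal_def inner_commute)
qed

lemma normal_derivative_slope:
  "normal_derivative w (slope w) x = unit_normal w x \<bullet> (hessian w x *v unit_normal w x)"
  by (simp add: normal_derivative_def grad_slope inner_commute)

lemma block_diagonal_hessian:
  assumes "tangential_grad (tangent_space (level_set U w x) x) (slope w) x = 0"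
  shows "block_diagonal (tangent_space (level_set U w x) x) (unit_normal w x) (hessian w x)
     (\<lambda>\<tau> \<eta>. slope w x * second_fundamental_form w x \<tau> \<eta>) (normal_derivative w (slope w) x)"
  using hessian_normal_tangent[OF assms] hessian_symmetric
  by (intro block_diagonal_normal)
    (simp_all add: second_fundamental_form_eq normal_derivative_slope inner_commute)

text \<open>In \<open>inner_Mp\<close> the rank-one term vanishes on two tangent vectors, involves
  only the vanishing mixed Hessian entry on a mixed pair, and raises the coefficient from 1 to
  \<open>p - 1\<close> on the normal.\<close>

lemma block_diagonal_Mp:
  assumes "tangential_grad (tangent_space (level_set U w x) x) (slope w) x = 0"
  shows "block_diagonal (tangent_space (level_set U w x) x) (unit_normal w x) (Mp p w x)
     (\<lambda>\<tau> \<eta>. slope w x powr (p - 2) * (slope w x * second_fundamental_form w x \<tau> \<eta>))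
     (slope w x powr (p - 2) * ((p - 1) * normal_derivative w (slope w) x))"
proof -
  let ?n = "unit_normal w x"
  have nn: "?n \<bullet> ?n = 1" using norm_unit_normal by (simp add: dot_square_norm)
  note tan = hessian_normal_tangent[OF assms]
  have tan': "\<tau> \<bullet> (hessian w x *v ?n) = 0" if "?n \<bullet> \<tau> = 0" for \<tau>
    using tan[OF that] hessian_symmetric by metis
  show ?thesis
  proof (rule block_diagonal_normal)
    fix \<tau> \<eta> assume "?n \<bullet> \<tau> = 0" "?n \<bullet> \<eta> = 0"
    then show "\<tau> \<bullet> (Mp p w x *v \<eta>) =
        slope w x powr (p - 2) * (slope w x * second_fundamental_form w x \<tau> \<eta>)"
      using hessian_symmetric[of \<tau> \<eta>]
      by (simp add: inner_Mp second_fundamental_form_eq inner_commute)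
  next
    show "?n \<bullet> (Mp p w x *v ?n) =
        slope w x powr (p - 2) * ((p - 1) * normal_derivative w (slope w) x)"
      by (simp add: inner_Mp nn normal_derivative_slope field_simps)
  qed (simp_all add: inner_Mp tan tan')
qed

lemma psd_hessian_iff_psd_Mp:
  assumes "1 < p" and t: "tangential_grad (tangent_space (level_set U w x) x) (slope w) x = 0"
  shows "psd (hessian w x) \<longleftrightarrow> psd (Mp p w x)"
  unfolding psd_block_diagonal[OF block_diagonal_hessian[OF t] transpose_eq_selfI[OF hessian_symmetric]]
    psd_block_diagonal[OF block_diagonal_Mp[OF t] transpose_Mp]
  using slope_pos assms(1) by (simp add: zero_le_mult_iff)

end

theorem corollary1p8:
  fixes p :: real and U :: "(real^'n) set" and w :: "real^'n \<Rightarrow> real" and x :: "real^'n"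
  assumes "1 < p" and "open U" and "C2_on U w" and "x \<in> U" and "grad w x \<noteq> 0"
  shows
    "(p = 2 \<longrightarrow> Mp 2 w x = hessian w x) \<and>
     (CARD('n) = 1 \<longrightarrow>
       (\<forall>i. let u = (\<lambda>t::real. w (vec t)); u' = deriv u (x $ i); u'' = deriv (deriv u) (x $ i)
            in Mp p w x = mat ((p - 1) * \<bar>u'\<bar> powr (p - 2) * u'') \<and>
               (psd (Mp p w x) \<longleftrightarrow> u'' \<ge> 0))) \<and>
     (let T = tangent_space (level_set U w x) x;
          \<nu> = unit_normal w x;
          s = slope w x;
          II = second_fundamental_form w x;
          s\<^sub>\<nu> = normal_derivative w (slope w) x
      in tangential_grad T (slope w) x = 0 \<longrightarrow>
           block_diagonal T \<nu> (hessian w x) (\<lambda>\<tau> \<eta>. s * II \<tau> \<eta>) s\<^sub>\<nu> \<and>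
           block_diagonal T \<nu> (Mp p w x)
             (\<lambda>\<tau> \<eta>. s powr (p - 2) * (s * II \<tau> \<eta>)) (s powr (p - 2) * ((p - 1) * s\<^sub>\<nu>)) \<and>
           (psd (hessian w x) \<longleftrightarrow> psd (Mp p w x)))"
proof -
  note C = assms(2-5)
  have "psd (Mp p w x) \<longleftrightarrow> 0 \<le> hessian w x $ i $ i" if N: "CARD('n) = 1" for i
  proof -
    \<comment> \<open>The single component carries the whole nonzero gradient, so the factor in
      front of the second derivative is positive and can be cancelled.\<close>
    have "grad w x $ i \<noteq> 0"
      using C(4) N card_1_singletonE[of "UNIV :: 'n set"] by (metis UNIV_I singletonD vec_eq_iff zero_index)
    then have "0 < (p - 1) * \<bar>grad w x $ i\<bar> powr (p - 2)" using assms(1) by simp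
    from mult_le_cancel_left_pos[OF this, of 0] show ?thesis
      unfolding Mp_dim_1[OF C N, of p i] psd_mat by (simp only: mult_zero_right)
  qed
  then show ?thesis
    unfolding Let_def
    using Mp_2[OF C] Mp_dim_1[OF C] deriv_line_1[OF C]
      block_diagonal_hessian[OF C] block_diagonal_Mp[OF C] psd_hessian_iff_psd_Mp[OF C assms(1)]
    by simp
qed

end
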